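(* Let $A,B$ be integers with $-B/2<A\leqslant B/2$ and let $\phi_{A,B}(z):=\operatorname{Li}_2(z)+4\pi^2A+2\pi iB\log z$. Let $\mathcal{R}'_{A,B}$ be the region obtained from the polar rectangle $\mathcal{R}_{A,B}=\{re^{i\theta}: r_1\leqslant r\leqslant r_2,\ \theta_1\leqslant\theta\leqslant\theta_2\}$ by replacing its boundary arc of radius $r_1$ by the straight segment joining its endpoints (the two corners $r_1e^{i\theta_1}$, $r_1e^{i\theta_2}$). If $\rho,c\in\mathcal{R}'_{A,B}$ with $\phi_{A,B}(\rho)=0$, and $c^*:=c-\phi_{A,B}(c)/\phi_{A,B}'(c)$, then $$|\rho-c^*|<B|\rho-c|^2\times\begin{cases}0.76&\text{if }A\neq0,\\2.51&\text{if }A=0.\end{cases}$$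
   Context: $\log$ is the principal logarithm ($-\pi<\arg z\leqslant\pi$). $\operatorname{Li}_2$ is the principal dilogarithm: $\sum_{n\geqslant1}z^n/n^2$ for $|z|\leqslant1$, continued to $\mathbb{C}\setminus[1,\infty)$ by $-\int_0^z\log(1-u)\,du/u$, and on $[1,\infty)$ defined as the limit from below. $\phi_{A,B}'(z):=\bigl(-\log(1-z)+2\pi iB\bigr)/z$. With $\kappa:=\sum_{n\geqslant1}\sin(\pi n/3)/n^2$: $r_1=1$, $r_2=\exp(\kappa/(\pi(2B-1)))$ if $-B/2<A<0$; $r_1=\exp(-\kappa/(2\pi B))$, $r_2=1$ if $0\leqslant A\leqslant B/2$; $\theta_1=\pi(2A-1/8)/B$ if $A\neq0$, $\theta_1=\pi/(24B)$ if $A=0$; $\theta_2=\pi(2A+1/8)/B$ if $A\neq B/2$, $\theta_2=\pi$ if $A=B/2$.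
   Formalization: The formal statement additionally assumes $c\neq\rho$; for $c=\rho$ one has $c^*=\rho$ and the strict inequality would read $0<0$, so it fails there. *)

theory Defs
  imports "HOL-Complex_Analysis.Complex_Analysis"
begin

text \<open>
  The dilogarithm on the plane cut along \<open>[1, \<infinity>)\<close>. The integrand is singular only
  at the starting point of the path, which does not affect the integral.
\<close>

definition dilog_cut :: "complex \<Rightarrow> complex" where
  "dilog_cut z = - contour_integral (linepath 0 z) (\<lambda>u. Ln (1 - u) / u)"

text \<open>
  On the cut \<open>(1, \<infinity>)\<close> the value is the limit from the lower half-plane, which matches
  the principal branch of \<open>Ln (1 - z)\<close> (imaginary part \<open>\<pi>\<close> there).
  At \<open>z = 1\<close> the series applies.
\<close>

definition dilog :: "complex \<Rightarrow> complex" where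
  "dilog z =
    (if norm z \<le> 1 then (\<Sum>n. z ^ Suc n / of_nat (Suc n) ^ 2)
     else if \<not> (Im z = 0 \<and> 1 \<le> Re z) then dilog_cut z
     else Lim (at z within {w. Im w < 0}) dilog_cut)"

definition phi :: "int \<Rightarrow> int \<Rightarrow> complex \<Rightarrow> complex" where
  "phi A B z = dilog z + 4 * of_real pi ^ 2 * of_int A + 2 * of_real pi * \<i> * of_int B * Ln z"

definition phi' :: "int \<Rightarrow> int \<Rightarrow> complex \<Rightarrow> complex" where
  "phi' A B z = (- Ln (1 - z) + 2 * of_real pi * \<i> * of_int B) / z"

definition kappa :: real where
  "kappa = (\<Sum>n. sin (pi * real (Suc n) / 3) / real (Suc n) ^ 2)"

definition r1 :: "int \<Rightarrow> int \<Rightarrow> real" where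
  "r1 A B = (if A < 0 then 1 else exp (- kappa / (2 * pi * of_int B)))"

definition r2 :: "int \<Rightarrow> int \<Rightarrow> real" where
  "r2 A B = (if A < 0 then exp (kappa / (pi * (2 * of_int B - 1))) else 1)"

definition theta1 :: "int \<Rightarrow> int \<Rightarrow> real" where
  "theta1 A B = (if A \<noteq> 0 then pi * (2 * of_int A - 1/8) / of_int B else pi / (24 * of_int B))"

definition theta2 :: "int \<Rightarrow> int \<Rightarrow> real" where
  "theta2 A B = (if 2 * A \<noteq> B then pi * (2 * of_int A + 1/8) / of_int B else pi)"

definition polar_rect :: "real \<Rightarrow> real \<Rightarrow> real \<Rightarrow> real \<Rightarrow> complex set" where
  "polar_rect s1 s2 t1 t2 = {rcis r t | r t. s1 \<le> r \<and> r \<le> s2 \<and> t1 \<le> t \<and> t \<le> t2}"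

text \<open>
  The boundary of the polar rectangle with its arc of radius \<open>s1\<close> replaced by the chord,
  and the closed region enclosed by that curve.
\<close>

definition chord_boundary :: "real \<Rightarrow> real \<Rightarrow> real \<Rightarrow> real \<Rightarrow> complex set" where
  "chord_boundary s1 s2 t1 t2 =
     (frontier (polar_rect s1 s2 t1 t2) - {rcis s1 t | t. t1 \<le> t \<and> t \<le> t2})
     \<union> closed_segment (rcis s1 t1) (rcis s1 t2)"

definition chord_region :: "real \<Rightarrow> real \<Rightarrow> real \<Rightarrow> real \<Rightarrow> complex set" where
  "chord_region s1 s2 t1 t2 =
     chord_boundary s1 s2 t1 t2 \<union> inside (chord_boundary s1 s2 t1 t2)"

definition region' :: "int \<Rightarrow> int \<Rightarrow> complex set" where
  "region' A B = chord_region (r1 A B) (r2 A B) (theta1 A B) (theta2 A B)"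

end

(* The Taylor remainder at c gives |rho - c*| <= max|phi''| / (2|phi'(c)|) * |rho - c|^2, the maximum
   being over a convex set containing rho and c. On the closed convex hull of the polar rectangle,
   |z| >= 0.72 and |1 - z| is at least of order 1/B, so that
   phi''(z) = 1/(z(1 - z)) - (2 pi i B - Log(1 - z))/z^2 is O(B), while |phi'(c)| is at least of
   order B. The resulting ratio is bounded, and it lies below the required multiple of B with room
   to spare, so crude bounds for pi, log 2 and kappa suffice. *)

theory Submission
  imports Defs
begin

text \<open>The sign of A decides on which side of the real axis the hull lies. For A \<ge> 0 it
  lies in the closed upper half of the unit disc, and 2 pi i B - Log(1 - z) has imaginary part at
  least 2 pi B. For A < 0 it lies in the open lower half-plane, and only pi (2 B - 1) is available.
  Two obstacles precede any differentiation of phi. The series that defines Li_2 on the closed disc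
  must be matched with the integral, because the regions reach the unit circle; and the principal
  Log jumps on the negative axis, which the region meets if A = B/2. Since the ratio is bounded
  while the target grows with B, it suffices to check the least B that the sign of A admits: 1 for A
  = 0, 2 for A > 0, 3 for A < 0. The larger constant for A = 0 reflects that this region comes
  closest to the singularity at 1.\<close>

section \<open>Taylor remainder of a Newton step\<close>

lemma newton_step_bound:
  fixes F F' F'' :: "complex \<Rightarrow> complex"
  assumes K: "convex K" "c \<in> K" "\<rho> \<in> K"
    and F: "\<And>z. z \<in> K \<Longrightarrow> (F has_field_derivative F' z) (at z)"
    and F': "\<And>z. z \<in> K \<Longrightarrow> (F' has_field_derivative F'' z) (at z)"
    and M: "\<And>z. z \<in> K \<Longrightarrow> norm (F'' z) \<le> M"
    and p: "0 < p" "p \<le> norm (F' c)"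
    and root: "F \<rho> = 0"
  shows "norm (\<rho> - (c - F c / F' c)) \<le> M / (2 * p) * norm (\<rho> - c) ^ 2"
proof -
  define d where "d = \<rho> - c"
  define r where "r = F c + F' c * d"
  have M0: "0 \<le> M" using M[OF K(2)] norm_ge_zero order_trans by blast
  \<comment> \<open>Lagrange's remainder needs real values, so project onto the direction of the remainder.\<close>
  define e where "e = cnj (- r) / of_real (norm r)"
  \<comment> \<open>For m = 0, 1, 2 this is the m-th derivative, along the segment from c to \<rho>,
    of the projected function.\<close>
  define h where "h = (\<lambda>(m::nat) (t::real). Re (e * (if m = 0 then F (c + of_real t * d)
        else if m = 1 then F' (c + of_real t * d) * d else F'' (c + of_real t * d) * d\<^sup>2)))"
  have seg: "c + of_real t * d \<in> K" if "0 \<le> t" "t \<le> 1" for t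
  proof -
    have "(1 - t) *\<^sub>R c + t *\<^sub>R \<rho> \<in> K" using K that by (intro convexD) auto
    then show ?thesis by (simp add: d_def scaleR_conv_of_real algebra_simps)
  qed
  have der: "DERIV (h m) t :> h (Suc m) t" if "m < 2" "0 \<le> t" "t \<le> 1" for m t
  proof -
    have line: "((\<lambda>t. c + of_real t * d) has_vector_derivative d) (at t)"
      by (auto intro!: derivative_eq_intros simp: scaleR_conv_of_real)
    have chain: "((\<lambda>t. f (c + of_real t * d)) has_vector_derivative d * f') (at t)"
      if "(f has_field_derivative f') (at (c + of_real t * d))" for f f'
      using field_vector_diff_chain_at[OF line that] by (simp add: o_def)
    have ReD: "((\<lambda>t. Re (e * g t)) has_real_derivative Re (e * g')) (at t)"
      if "(g has_vector_derivative g') (at t)" for g g'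
      using bounded_linear.has_vector_derivative[OF bounded_linear_Re has_vector_derivative_mult_right[OF that, of e]]
      by (simp add: has_real_derivative_iff_has_vector_derivative)
    note s = seg[OF that(2,3)]
    consider "m = 0" | "m = 1" using \<open>m < 2\<close> by linarith
    then show ?thesis
    proof cases
      case 1
      show ?thesis unfolding h_def 1 using ReD[OF chain[OF F[OF s]]] by (simp add: mult.commute)
    next
      case 2
      show ?thesis unfolding h_def 2
        using ReD[OF has_vector_derivative_mult_left[OF chain[OF F'[OF s]], of d]]
        by (simp add: power2_eq_square algebra_simps)
    qed
  qed
  obtain t where t: "0 < t" "t < 1" "h 0 1 = (\<Sum>m<2. h m 0 / fact m * (1 - 0) ^ m) + h 2 t / fact 2 * (1 - 0) ^ 2"
    using Taylor_up[of 2 h "h 0" 0 1 0] der by auto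
  \<comment> \<open>The value at 1 is Re (e * F \<rho>) = 0, and the terms of order 0 and 1 add up
    to Re (e * r), so the second-order term alone balances r.\<close>
  have eq: "0 = Re (e * r) + h 2 t / 2"
    using t(3) root by (simp add: h_def r_def numeral_2_eq_2 d_def algebra_simps)
  have er: "e * r = - of_real (norm r)"
  proof (cases "r = 0")
    case False
    then show ?thesis
      by (simp add: e_def complex_norm_square power2_eq_square field_simps flip: of_real_mult)
         (metis complex_norm_square mult.commute power2_eq_square of_real_mult)
  qed auto
  \<comment> \<open>The norm is 1 unless r = 0, where division by zero makes e vanish.\<close>
  have "norm e \<le> 1" by (simp add: e_def norm_divide)
  then have "norm e * (norm (F'' (c + of_real t * d)) * norm d ^ 2) \<le> 1 * (M * norm d ^ 2)"
    using M[OF seg, of t] t M0 by (intro mult_mono mult_right_mono) auto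
  then have "h 2 t \<le> M * norm d ^ 2"
    using complex_Re_le_cmod[of "e * (F'' (c + of_real t * d) * d\<^sup>2)"]
    by (simp add: h_def norm_mult norm_power)
  with eq er have r: "norm r \<le> M * norm d ^ 2 / 2" by simp
  have "F' c \<noteq> 0" using p by auto
  then have "\<rho> - (c - F c / F' c) = r / F' c" by (simp add: r_def d_def field_simps)
  then have "norm (\<rho> - (c - F c / F' c)) = norm r / norm (F' c)" by (simp add: norm_divide)
  also have "\<dots> \<le> (M * norm d ^ 2 / 2) / p" using r p M0 by (intro frac_le) auto
  finally show ?thesis by (simp add: d_def)
qed

section \<open>The chord region inside a convex set\<close>

text \<open>A convex set has empty inside, so the inside of a curve that it contains cannot leave
  it. This avoids determining the inside of the curve.\<close>

lemma chord_region_subset_convex: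
  assumes "convex K" "closed K" "polar_rect s1 s2 t1 t2 \<subseteq> K" "s1 \<le> s2" "t1 \<le> t2"
  shows "chord_region s1 s2 t1 t2 \<subseteq> K"
proof -
  have "frontier (polar_rect s1 s2 t1 t2) \<subseteq> K"
    using closure_minimal[OF assms(3,2)] by (auto simp: frontier_def)
  moreover have "rcis s1 t1 \<in> K" "rcis s1 t2 \<in> K"
    using assms by (auto simp: polar_rect_def)
  ultimately have b: "chord_boundary s1 s2 t1 t2 \<subseteq> K"
    using assms(1) by (auto simp: chord_boundary_def closed_segment_subset subset_iff dest: closed_segment_subset[THEN subsetD])
  with inside_mono[OF b] inside_convex[OF assms(1)] show ?thesis
    by (auto simp: chord_region_def)
qed

section \<open>Bounds for kappa\<close>

lemma inverse_Suc_squares_sums: "(\<lambda>n. 1 / real (Suc n) ^ 2) sums (pi\<^sup>2 / 6)"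
  using inverse_squares_sums by (simp only: Suc_eq_plus1 of_nat_power)

lemma kappa_summable: "summable (\<lambda>n. sin (pi * real (Suc n) / 3) / real (Suc n) ^ 2)"
  by (rule summable_comparison_test'[OF sums_summable[OF inverse_Suc_squares_sums], of 0])
     (auto simp: divide_right_mono)

lemma kappa_le: "kappa \<le> pi\<^sup>2 / 6"
proof -
  have "kappa \<le> (\<Sum>n. 1 / real (Suc n) ^ 2)"
    unfolding kappa_def
    using kappa_summable sums_summable[OF inverse_Suc_squares_sums]
    by (intro suminf_le) (auto simp: divide_right_mono)
  also have "\<dots> = pi\<^sup>2 / 6" using inverse_Suc_squares_sums by (rule sums_unique[symmetric])
  finally show ?thesis .
qed

text \<open>Over a period of six terms the sines are sqrt 3 / 2 times 1, 1, 0, -1, -1, 0, and the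
  positive ones carry the larger weights. The sign of kappa is what gives r1 \<le> 1 \<le>
  r2.\<close>

lemma kappa_nonneg: "0 \<le> kappa"
proof -
  define f where "f n = sin (pi * real (Suc n) / 3) / real (Suc n) ^ 2" for n
  have "f sums kappa"
    using summable_sums[OF kappa_summable] by (simp add: f_def[abs_def] kappa_def)
  from sums_group[OF this, of 6] have s: "(\<lambda>k. sum f {k * 6..<k * 6 + 6}) sums kappa" by simp
  have "0 \<le> sum f {k * 6..<k * 6 + 6}" for k
  proof -
    have sn: "sin (pi * real (k * 6 + j) / 3) = sin (pi * real j / 3)" for j
    proof -
      have "pi * real (k * 6 + j) / 3 = pi * real j / 3 + real k * (2 * pi)" by (simp add: field_simps)
      moreover have "sin (real k * (2 * pi)) = 0" "cos (real k * (2 * pi)) = 1"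
        using sin_2npi[of k] cos_2npi[of k] by (simp_all only: mult_ac)
      ultimately show ?thesis by (simp only: sin_add)
    qed
    have v: "sin (pi * 2 / 3) = sqrt 3 / 2" "sin (pi * 4 / 3) = - sqrt 3 / 2" "sin (pi * 5 / 3) = - sqrt 3 / 2" "sin (pi * 6 / 3) = 0"
      using sin_pi_minus[of "pi/3"] sin_periodic_pi[of "pi/3"] sin_periodic_pi[of "2*pi/3"] sin_60 sin_two_pi
      by (simp_all add: field_simps)
    have fe: "f (k * 6 + j) = sin (pi * real (Suc j) / 3) / real (k * 6 + Suc j) ^ 2" for j
      using sn[of "Suc j"] by (simp add: f_def)
    have "{k * 6..<k * 6 + 6} = {k*6, k*6+1, k*6+2, k*6+3, k*6+4, k*6+5}" by auto
    then have "sum f {k * 6..<k * 6 + 6} = f (k*6) + f (k*6+1) + f (k*6+2) + f (k*6+3) + f (k*6+4) + f (k*6+5)"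
      by simp
    also have "\<dots> = sqrt 3 / 2 * (1 / real (k*6+1)^2 + 1 / real (k*6+2)^2 - 1 / real (k*6+4)^2 - 1 / real (k*6+5)^2)"
      using fe[of 0] fe[of 1] fe[of 2] fe[of 3] fe[of 4] fe[of 5] v sin_60
      by (simp add: right_diff_distrib distrib_left)
    also have "\<dots> \<ge> 0"
    proof -

      have "1 / real (k*6+4)^2 \<le> 1 / real (k*6+1)^2" "1 / real (k*6+5)^2 \<le> 1 / real (k*6+2)^2"
        by (intro divide_left_mono power_mono zero_less_power mult_pos_pos; simp)+
      then show ?thesis by simp
    qed
    finally show ?thesis .
  qed
  then show ?thesis using sums_le[OF _ sums_zero s] by blast
qed

section \<open>The dilogarithm on the slit plane\<close>

lemma one_minus_notin_nonpos_Reals_iff: "1 - (z::complex) \<notin> \<real>\<^sub>\<le>\<^sub>0 \<longleftrightarrow> \<not> (Im z = 0 \<and> 1 \<le> Re z)"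
  by (auto simp: complex_nonpos_Reals_iff)

text \<open>Fills the removable singularity: -1 is the derivative of \<open>Ln (1 - u)\<close> at 0,
  whereas the integrand of \<open>dilog_cut\<close> is 0 there by the convention for division by
  zero.\<close>

definition log_quot :: "complex \<Rightarrow> complex" where
  "log_quot u = (if u = 0 then - 1 else Ln (1 - u) / u)"

lemma open_slit_plane: "open {z::complex. 1 - z \<notin> \<real>\<^sub>\<le>\<^sub>0}"
proof -
  have "closed ((\<lambda>z::complex. 1 - z) -` \<real>\<^sub>\<le>\<^sub>0)"
    by (intro closed_vimage continuous_intros) auto
  then show ?thesis by (simp add: closed_def vimage_def Collect_neg_eq)
qed

lemma closed_segment_0_subset_slit_plane:
  fixes z :: complex
  assumes "1 - z \<notin> \<real>\<^sub>\<le>\<^sub>0"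
  shows "closed_segment 0 z \<subseteq> {z. 1 - z \<notin> \<real>\<^sub>\<le>\<^sub>0}"
proof -
  have "{z::complex. 1 - z \<notin> \<real>\<^sub>\<le>\<^sub>0} = - (complex_of_real ` {1..})"
    by (auto simp: one_minus_notin_nonpos_Reals_iff complex_slot_right_eq)
  then show ?thesis
    using starlike_slotted_complex_plane_right_aux[of z 1 0] assms by auto
qed

lemma field_differentiable_log_quot:
  assumes "1 - z \<notin> \<real>\<^sub>\<le>\<^sub>0" "z \<noteq> 0"
  shows "log_quot field_differentiable at z"
proof -
  have "(\<lambda>u. Ln (1 - u) / u) field_differentiable at z"
    using assms by (intro field_differentiable_divide field_differentiable_ident)
      (auto simp: field_differentiable_def intro!: derivative_eq_intros)
  then show ?thesis
    using assms has_field_derivative_transform_within_open[of "\<lambda>u. Ln (1 - u) / u" _ z "- {0}" log_quot]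
    by (auto simp: field_differentiable_def log_quot_def)
qed

lemma continuous_on_log_quot: "continuous_on {z. 1 - z \<notin> \<real>\<^sub>\<le>\<^sub>0} log_quot"
proof (rule continuous_at_imp_continuous_on, safe)
  fix z :: complex assume z: "1 - z \<notin> \<real>\<^sub>\<le>\<^sub>0"
  show "isCont log_quot z"
  proof (cases "z = 0")
    case True
    have "((\<lambda>u. Ln (1 - u)) has_field_derivative - 1) (at 0)"
      by (auto intro!: derivative_eq_intros)
    then have "((\<lambda>u. Ln (1 - u) / u) \<longlongrightarrow> - 1) (at 0)"
      by (simp add: DERIV_def)
    then have "(log_quot \<longlongrightarrow> - 1) (at 0)"
      by (rule Lim_transform_eventually) (auto simp: log_quot_def eventually_at_filter)
    then show ?thesis by (simp add: isCont_def True log_quot_def)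
  qed (use z field_differentiable_log_quot field_differentiable_imp_continuous_at in blast)
qed

lemma dilog_cut_has_field_derivative_log_quot:
  assumes "1 - z \<notin> \<real>\<^sub>\<le>\<^sub>0"
  shows "(dilog_cut has_field_derivative - log_quot z) (at z)"
proof -
  let ?S = "{z::complex. 1 - z \<notin> \<real>\<^sub>\<le>\<^sub>0}"
  note star0 = closed_segment_0_subset_slit_plane
  have "starlike ?S" unfolding starlike_def using star0 by (intro bexI[of _ 0]) auto
  obtain G where G: "\<And>z. z \<in> ?S \<Longrightarrow> (G has_field_derivative log_quot z) (at z)"
    \<comment> \<open>The exceptional set {0} is the point where only continuity of
      \<open>log_quot\<close> has been established.\<close>
    using holomorphic_starlike_primitive[OF continuous_on_log_quot \<open>starlike ?S\<close> open_slit_plane, of "{0}"]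
      field_differentiable_log_quot by auto
  have eq: "dilog_cut z = - (G z - G 0)" if z: "z \<in> ?S" for z
  proof -
    have "contour_integral (linepath 0 z) (\<lambda>u. Ln (1 - u) / u) = contour_integral (linepath 0 z) log_quot"
    proof (cases "z = 0")
      case False
      then show ?thesis
        unfolding contour_integral_integral
        \<comment> \<open>The two integrands differ only at parameter 0, where the path starts at
          the origin.\<close>
        by (intro integral_spike[of "{0}"]) (auto simp: log_quot_def linepath_def)
    qed simp
    also have "(log_quot has_contour_integral (G z - G 0)) (linepath 0 z)"
      using contour_integral_primitive[of ?S G log_quot "linepath 0 z"] G star0[of z] z
      by (auto intro: has_field_derivative_at_within)
    then have "contour_integral (linepath 0 z) log_quot = G z - G 0"
      by (rule contour_integral_unique)
    finally show ?thesis by (simp add: dilog_cut_def)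
  qed
  have "((\<lambda>z. - (G z - G 0)) has_field_derivative - log_quot z) (at z)"
    using G assms by (auto intro!: derivative_eq_intros)
  then show ?thesis
    by (rule has_field_derivative_transform_within_open[OF _ open_slit_plane]) (use assms eq in auto)
qed

lemma dilog_cut_has_field_derivative:
  assumes "1 - z \<notin> \<real>\<^sub>\<le>\<^sub>0" "z \<noteq> 0"
  shows "(dilog_cut has_field_derivative - Ln (1 - z) / z) (at z)"
  using dilog_cut_has_field_derivative_log_quot[OF assms(1)] assms(2) by (simp add: log_quot_def)

definition dilog_series :: "complex \<Rightarrow> complex" where
  "dilog_series z = (\<Sum>n. z ^ Suc n / of_nat (Suc n) ^ 2)"

lemma continuous_on_dilog_series: "continuous_on (cball 0 1) dilog_series"
proof -
  have "uniform_limit (cball 0 1) (\<lambda>n z. \<Sum>i<n. z ^ Suc i / of_nat (Suc i) ^ 2) dilog_series sequentially"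
    unfolding dilog_series_def
  proof (rule Weierstrass_m_test)
    show "summable (\<lambda>n. 1 / real (Suc n) ^ 2)" using inverse_Suc_squares_sums by (rule sums_summable)
    show "norm (z ^ Suc n / of_nat (Suc n) ^ 2) \<le> 1 / real (Suc n) ^ 2" if "z \<in> cball 0 1" for n and z :: complex
    proof -
      have "norm (z ^ Suc n) \<le> 1" using that power_le_one[of "norm z" "Suc n"] by (simp only: norm_power) simp
      then show ?thesis by (simp only: norm_divide norm_power norm_of_nat divide_right_mono zero_le_power2)
    qed
  qed
  then show ?thesis by (rule uniform_limit_theorem[rotated]) (auto intro!: always_eventually continuous_intros simp del: of_nat_Suc)
qed

lemma dilog_series_has_field_derivative:
  assumes "norm z < 1"
  shows "(dilog_series has_field_derivative - log_quot z) (at z)"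
proof -
  define a :: "nat \<Rightarrow> complex" where "a n = (if n = 0 then 0 else 1 / of_nat n ^ 2)" for n
  have sm: "summable (\<lambda>n. a n * w ^ n)" if "norm w < 1" for w :: complex
  proof (rule summable_comparison_test'[of "\<lambda>n. norm w ^ n" 0])
    show "summable (\<lambda>n. norm w ^ n)" using that by simp
    have "norm (a n) \<le> 1" for n
      using one_le_power[of "real n" 2] by (auto simp: a_def norm_divide norm_power divide_le_eq_1)
    then show "norm (a n * w ^ n) \<le> norm w ^ n" for n
      by (simp add: norm_mult norm_power mult_left_le_one_le)
  qed
  have eq: "dilog_series w = (\<Sum>n. a n * w ^ n)" if "norm w < 1" for w :: complex
    using suminf_split_head[OF sm[OF that]] by (simp add: dilog_series_def a_def)
  have "((\<lambda>w. \<Sum>n. a n * w ^ n) has_field_derivative (\<Sum>n. diffs a n * z ^ n)) (at z)"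
    using sm assms by (intro termdiffs_strong'[of 1]) auto
  moreover have "(\<Sum>n. diffs a n * z ^ n) = - log_quot z"
  proof (cases "z = 0")
    case True
    then show ?thesis unfolding True powser_zero by (simp add: log_quot_def diffs_def a_def)
  next
    case False
    have d: "diffs a n * z ^ n = - (1 / z) * (- (z ^ Suc n) / of_nat (Suc n))" for n
      using False by (simp add: diffs_def a_def power2_eq_square field_simps del: of_nat_Suc)
    have "(\<lambda>n. - (z ^ n) / of_nat n) sums Ln (1 - z)"
      using Ln_series'[of "- z"] assms by simp
    \<comment> \<open>The term for n = 0 vanishes because it is a division by zero, so the shift of
      index keeps the sum.\<close>
    then have "(\<lambda>n. - (z ^ Suc n) / of_nat (Suc n)) sums Ln (1 - z)"
      by (subst sums_Suc_iff) simp
    from sums_mult[OF this, of "- (1 / z)"]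
    have "(\<lambda>n. diffs a n * z ^ n) sums (- (1 / z) * Ln (1 - z))" by (simp only: d)
    then show ?thesis using False by (simp add: sums_iff log_quot_def)
  qed
  ultimately have "((\<lambda>w. \<Sum>n. a n * w ^ n) has_field_derivative - log_quot z) (at z)" by simp
  then show ?thesis
    by (rule has_field_derivative_transform_within_open[of _ _ _ "ball 0 1"]) (use assms eq in auto)
qed

text \<open>Series and integral have the same derivative on the open disc and agree at 0; a point of
  the unit circle other than 1 is reached by continuity along its radius. Outside the closed disc
  the equality is the definition.\<close>

lemma dilog_eq_dilog_cut:
  assumes z: "1 - z \<notin> \<real>\<^sub>\<le>\<^sub>0"
  shows "dilog z = dilog_cut z"
proof (cases "norm z \<le> 1")
  case True
  note D = dilog_cut_has_field_derivative_log_quot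
  define H where "H w = dilog_series w - dilog_cut w" for w
  have disc: "1 - w \<notin> \<real>\<^sub>\<le>\<^sub>0" if "norm w < 1" for w :: complex
    using that abs_Re_le_cmod[of w] by (auto simp: one_minus_notin_nonpos_Reals_iff)
  have H0: "H w = 0" if "w \<in> ball 0 1" for w
  proof -
    have "(H has_field_derivative 0) (at w within ball 0 1)" if "w \<in> ball 0 1" for w
      using that DERIV_diff[OF dilog_series_has_field_derivative[of w] D[OF disc[of w]]]
      by (auto simp: H_def[abs_def] intro: has_field_derivative_at_within)
    then obtain k where k: "\<And>w. w \<in> ball 0 1 \<Longrightarrow> H w = k"
      using has_field_derivative_zero_constant[of "ball 0 1" H] by auto
    moreover have "H 0 = 0" by (simp add: H_def dilog_series_def dilog_cut_def)
    ultimately show ?thesis using that by (metis centre_in_ball zero_less_one)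
  qed
  have seg: "1 - of_real t * z \<notin> \<real>\<^sub>\<le>\<^sub>0" if "t \<in> {0..1}" for t
  proof -
    have "of_real t * z \<in> closed_segment 0 z"
      using that by (auto simp: closed_segment_def scaleR_conv_of_real intro!: exI[of _ t])
    then show ?thesis using closed_segment_0_subset_slit_plane[OF z] by blast
  qed
  have "continuous_on {0..1} (\<lambda>t. H (of_real t * z))"
  proof -
    have "continuous_on ((\<lambda>t. of_real t * z) ` {0..1}) dilog_series"
      by (rule continuous_on_subset[OF continuous_on_dilog_series])
         (use True in \<open>auto simp: norm_mult intro!: mult_le_one\<close>)
    moreover have "continuous_on ((\<lambda>t. of_real t * z) ` {0..1}) dilog_cut"
      using seg D by (intro DERIV_continuous_on[of _ _ "\<lambda>z. - log_quot z"]) (auto intro: has_field_derivative_at_within)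
    ultimately have "continuous_on ((\<lambda>t. of_real t * z) ` {0..1}) H"
      unfolding H_def by (rule continuous_on_diff)
    then show ?thesis by (rule continuous_on_compose2) (auto intro!: continuous_intros)
  qed
  moreover have "H (of_real t * z) = 0" if "t \<in> {0..<1}" for t
  proof -
    have "t * norm z \<le> t * 1" using that True by (intro mult_left_mono) auto
    then show ?thesis using that by (intro H0) (auto simp: norm_mult)
  qed
  moreover have "closure {0..<1::real} = {0..1}" by simp
  ultimately have "H (of_real 1 * z) = 0"
    using continuous_constant_on_closure[of "{0..<1}" "\<lambda>t. H (of_real t * z)" 0 1] by auto
  then show ?thesis using True by (simp add: H_def dilog_def dilog_series_def)
qed (use z in \<open>simp add: dilog_def one_minus_notin_nonpos_Reals_iff\<close>)

section \<open>A branch of the logarithm and the Newton step for phi\<close>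

text \<open>
  The right-hand side is differentiable on the negative real axis too, which the region meets
  if \<open>A = B / 2\<close> and where \<open>Ln\<close> itself jumps.
\<close>

lemma Ln_eq_Ln_times_minus_ii:
  assumes "0 \<le> Im z" "z \<noteq> 0"
  shows "Ln z = Ln (- \<i> * z) + \<i> * of_real pi / 2"
proof (rule Ln_unique)
  have "exp (\<i> * of_real pi / 2) = \<i>"
    using cis_conv_exp[of "pi / 2"] by (simp add: mult.commute)
  moreover have "- \<i> * z * \<i> = z" by (simp add: complex_eq_iff)
  ultimately show "exp (Ln (- \<i> * z) + \<i> * of_real pi / 2) = z"
    using assms by (simp add: exp_add)
  \<comment> \<open>Multiplication by -i turns the closed upper half-plane into the closed right
    one, so adding pi/2 to the argument lands in [0, pi].\<close>
  have "\<bar>Im (Ln (- \<i> * z))\<bar> \<le> pi / 2"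
    using assms by (subst Re_Ln_pos_le) auto
  then have "- pi < Im (Ln (- \<i> * z)) + pi / 2" "Im (Ln (- \<i> * z)) + pi / 2 \<le> pi"
    using pi_gt_zero by linarith+
  then show "- pi < Im (Ln (- \<i> * z) + \<i> * of_real pi / 2)" "Im (Ln (- \<i> * z) + \<i> * of_real pi / 2) \<le> pi"
    by simp_all
qed

text \<open>The hypothesis \<open>side\<close> provides a single holomorphic branch of the logarithm
  on K that agrees with \<open>Ln\<close>: the rotated one on the closed upper half-plane,
  \<open>Ln\<close> itself on the open lower one.\<close>

lemma newton_step_phi_bound:
  assumes K: "convex K" "c \<in> K" "\<rho> \<in> K"
    and side: "(\<forall>z\<in>K. 0 \<le> Im z) \<or> (\<forall>z\<in>K. Im z < 0)"
    and m: "0 < m" "\<And>z. z \<in> K \<Longrightarrow> m \<le> norm z"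
    and d: "0 < d" "\<And>z. z \<in> K \<Longrightarrow> d \<le> norm (1 - z)"
    and slit: "\<And>z. z \<in> K \<Longrightarrow> 1 - z \<notin> \<real>\<^sub>\<le>\<^sub>0"
    and L: "\<And>z. z \<in> K \<Longrightarrow> norm (- Ln (1 - z) + 2 * of_real pi * \<i> * of_int B) \<le> L"
    and p: "0 < p" "p \<le> norm (phi' A B c)"
    and root: "phi A B \<rho> = 0"
  shows "norm (\<rho> - (c - phi A B c / phi' A B c)) \<le> (1 / (m * d) + L / m\<^sup>2) / (2 * p) * norm (\<rho> - c) ^ 2"
proof -
  have nz: "z \<noteq> 0" if "z \<in> K" for z using m that by fastforce
  have slit_nz: "1 - z \<noteq> 0" if "z \<in> K" for z using slit[OF that] by auto
  obtain l where l: "\<And>z. z \<in> K \<Longrightarrow> l z = Ln z"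
    "\<And>z. z \<in> K \<Longrightarrow> (l has_field_derivative 1 / z) (at z)"
  proof (cases "\<forall>z\<in>K. 0 \<le> Im z")
    case True
    show thesis
    proof
      fix z assume z: "z \<in> K"
      then show "Ln (- \<i> * z) + \<i> * of_real pi / 2 = Ln z"
        using Ln_eq_Ln_times_minus_ii True nz by simp
      have "- \<i> * z \<notin> \<real>\<^sub>\<le>\<^sub>0" using z True nz[OF z] by (auto simp: complex_nonpos_Reals_iff complex_eq_iff)
      then show "((\<lambda>z. Ln (- \<i> * z) + \<i> * of_real pi / 2) has_field_derivative 1 / z) (at z)"
        using nz[OF z] by (auto intro!: derivative_eq_intros simp: field_simps)
    qed
  next
    case False
    with side have "Im z < 0" if "z \<in> K" for z using that by blast
    then have "z \<notin> \<real>\<^sub>\<le>\<^sub>0" if "z \<in> K" for z using that by (fastforce simp: complex_nonpos_Reals_iff)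
    then show thesis
      by (intro that[of Ln]) (auto intro!: derivative_eq_intros simp: divide_inverse)
  qed
  \<comment> \<open>Unlike the defining cases of \<open>phi\<close>, this is differentiable in full
    neighbourhoods of points of K on the unit circle and on the negative axis.\<close>
  define F where "F z = dilog_cut z + 4 * of_real pi ^ 2 * of_int A + 2 * of_real pi * \<i> * of_int B * l z" for z
  define F'' where "F'' z = 1 / ((1 - z) * z) - (- Ln (1 - z) + 2 * of_real pi * \<i> * of_int B) / z\<^sup>2" for z
  have phi: "phi A B z = F z" if "z \<in> K" for z
    using that l(1) slit dilog_eq_dilog_cut by (simp add: phi_def F_def)
  have F: "(F has_field_derivative phi' A B z) (at z)" if "z \<in> K" for z
    unfolding F_def[abs_def] phi'_def
    using dilog_cut_has_field_derivative[OF slit[OF that] nz[OF that]] l(2)[OF that]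
    by (auto intro!: derivative_eq_intros simp: diff_divide_distrib add_divide_distrib)
  have F': "(phi' A B has_field_derivative F'' z) (at z)" if "z \<in> K" for z
    unfolding F''_def phi'_def[abs_def]
    using slit[OF that] nz[OF that] slit_nz[OF that]
    by (auto intro!: derivative_eq_intros simp: diff_divide_distrib divide_inverse power2_eq_square)
  have "norm (F'' z) \<le> 1 / (m * d) + L / m\<^sup>2" if "z \<in> K" for z
  proof -
    have "0 \<le> L" using L[OF that] norm_ge_zero order_trans by blast
    have "norm (F'' z) \<le> norm (1 / ((1 - z) * z)) + norm ((- Ln (1 - z) + 2 * of_real pi * \<i> * of_int B) / z\<^sup>2)"
      unfolding F''_def by (rule norm_triangle_ineq4)
    also have "\<dots> \<le> 1 / (m * d) + L / m\<^sup>2"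
      unfolding norm_divide norm_mult norm_power norm_one
      using m(1) m(2)[OF that] d(1) d(2)[OF that] L[OF that] \<open>0 \<le> L\<close>
      by (subst mult.commute[of m]) (intro add_mono frac_le mult_mono power_mono; simp)
    finally show ?thesis .
  qed
  from newton_step_bound[OF K F F' this p]
  show ?thesis using root phi K by simp
qed

section \<open>Elementary bounds for sine and cosine\<close>

lemma cos_ge_one_minus_half_square: "1 - x\<^sup>2 / 2 \<le> cos (x::real)"
proof -
  have "cos x = 1 - 2 * (sin (x / 2))\<^sup>2"
    using cos_double_sin[of "x / 2"] by simp
  moreover have "(sin (x / 2))\<^sup>2 \<le> (x / 2)\<^sup>2"
    using abs_sin_x_le_abs_x[of "x / 2"] unfolding abs_le_square_iff .
  ultimately show ?thesis by (simp add: power2_eq_square)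
qed

lemma sin_ge_cubic:
  assumes "0 \<le> (x::real)"
  shows "x * (1 - x\<^sup>2 / 6) \<le> sin x"
proof -
  have "(\<Sum>m<3. sin_coeff m * x ^ m) = x"
    by (simp add: numeral_3_eq_3 sin_coeff_def)
  moreover have "inverse (fact 3) = (1 / 6 :: real)"
    by (simp add: fact_numeral)
  ultimately have "\<bar>sin x - x\<bar> \<le> 1 / 6 * \<bar>x\<bar> ^ 3"
    using Maclaurin_sin_bound[of x 3] by (simp only:)
  then have "x - x ^ 3 / 6 \<le> sin x" unfolding abs_of_nonneg[OF assms] by linarith
  also have "x - x ^ 3 / 6 = x * (1 - x\<^sup>2 / 6)"
    by (simp add: power2_eq_square power3_eq_cube right_diff_distrib)
  finally show ?thesis .
qed

section \<open>Geometry of the closed convex hull\<close>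

text \<open>Closedness is required to contain the frontier that enters
  \<open>chord_boundary\<close>. A closed convex condition holds on this set once it holds at the
  points \<open>rcis r t\<close>.\<close>

definition polar_hull :: "real \<Rightarrow> real \<Rightarrow> real \<Rightarrow> real \<Rightarrow> complex set" where
  "polar_hull s1 s2 t1 t2 = closure (convex hull (polar_rect s1 s2 t1 t2))"

lemma convex_polar_hull: "convex (polar_hull s1 s2 t1 t2)"
  unfolding polar_hull_def by (intro convex_closure convex_convex_hull)

lemma polar_rect_subset_polar_hull: "polar_rect s1 s2 t1 t2 \<subseteq> polar_hull s1 s2 t1 t2"
  unfolding polar_hull_def by (rule subset_trans[OF hull_subset closure_subset])

lemma chord_region_subset_polar_hull:
  assumes "s1 \<le> s2" "t1 \<le> t2"
  shows "chord_region s1 s2 t1 t2 \<subseteq> polar_hull s1 s2 t1 t2"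
  by (intro chord_region_subset_convex convex_polar_hull polar_rect_subset_polar_hull assms)
     (simp add: polar_hull_def)

lemma polar_hull_induct:
  assumes "z \<in> polar_hull s1 s2 t1 t2" "convex {z. P z}" "closed {z. P z}"
    and "\<And>r t. s1 \<le> r \<Longrightarrow> r \<le> s2 \<Longrightarrow> t1 \<le> t \<Longrightarrow> t \<le> t2 \<Longrightarrow> P (rcis r t)"
  shows "P z"
proof -
  have "polar_rect s1 s2 t1 t2 \<subseteq> {z. P z}" using assms(4) by (auto simp: polar_rect_def)
  then have "polar_hull s1 s2 t1 t2 \<subseteq> {z. P z}"
    unfolding polar_hull_def using assms(2,3) by (intro closure_minimal hull_minimal)
  then show ?thesis using assms(1) by auto
qed

text \<open>The lower bounds below for modulus and distance to 1, and the signs of the imaginary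
  part, each come from a half-plane with normal \<open>cnj w\<close>.\<close>

lemma polar_hull_half_plane:
  assumes "z \<in> polar_hull s1 s2 t1 t2"
    and "\<And>r t. s1 \<le> r \<Longrightarrow> r \<le> s2 \<Longrightarrow> t1 \<le> t \<Longrightarrow> t \<le> t2 \<Longrightarrow> k \<le> Re (rcis r t * w)"
  shows "k \<le> Re (z * w)"
proof -
  have eq: "{z. k \<le> Re (z * w)} = {z. inner (cnj w) z \<ge> k}"
    by (simp add: inner_complex_def algebra_simps)
  show ?thesis
  proof (rule polar_hull_induct[OF assms(1), where P = "\<lambda>z. k \<le> Re (z * w)"])
    show "convex {z. k \<le> Re (z * w)}" unfolding eq by (rule convex_halfspace_ge)
    show "closed {z. k \<le> Re (z * w)}" unfolding eq by (rule closed_halfspace_ge)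
  qed (rule assms(2))
qed

lemma norm_polar_hull_le:
  assumes "z \<in> polar_hull s1 s2 t1 t2" "0 \<le> s1"
  shows "norm z \<le> s2"
proof (rule polar_hull_induct[OF assms(1)])
  have "{z::complex. norm z \<le> s2} = cball 0 s2" by auto
  then show "convex {z::complex. norm z \<le> s2}" "closed {z::complex. norm z \<le> s2}" by auto
qed (use assms in auto)

lemma rcis_times_cis: "rcis r t * cis a = rcis r (t + a)"
  by (simp add: rcis_def cis_mult mult.assoc)

text \<open>Projection onto the bisector of the sector: the bound is the distance of the chord from
  the origin.\<close>

lemma norm_polar_hull_ge:
  assumes z: "z \<in> polar_hull s1 s2 t1 t2" and "0 \<le> s1" "t2 - t1 \<le> pi"
  shows "s1 * cos ((t2 - t1) / 2) \<le> norm z"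
proof -
  let ?a = "(t1 + t2) / 2"
  have "s1 * cos ((t2 - t1) / 2) \<le> Re (z * cis (- ?a))"
  proof (rule polar_hull_half_plane[OF z])
    fix r t assume rt: "s1 \<le> r" "r \<le> s2" "t1 \<le> t" "t \<le> t2"
    then have "cos ((t2 - t1) / 2) \<le> cos \<bar>t - ?a\<bar>"
      using assms(3) by (intro cos_monotone_0_pi_le) (auto simp: abs_le_iff field_simps)
    moreover have "0 \<le> cos ((t2 - t1) / 2)" using rt assms(3) by (intro cos_ge_zero) auto
    ultimately show "s1 * cos ((t2 - t1) / 2) \<le> Re (rcis r t * cis (- ?a))"
      unfolding rcis_times_cis using rt assms(2) by (auto intro!: mult_mono)
  qed
  also have "\<dots> \<le> norm z"
    using complex_Re_le_cmod[of "z * cis (- ?a)"] by (simp add: norm_mult)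
  finally show ?thesis .
qed

lemma Im_polar_hull_nonneg:
  assumes "z \<in> polar_hull s1 s2 t1 t2" "0 \<le> s1" "0 \<le> t1" "t2 \<le> pi"
  shows "0 \<le> Im z"
  using polar_hull_half_plane[OF assms(1), of 0 "- \<i>"] assms by (auto simp: sin_ge_zero)

text \<open>A strict inequality need not survive the closure, so a positive margin is carried along:
  on an interval inside (0, pi) the sine is at least its smaller endpoint value.\<close>

lemma Im_polar_hull_neg:
  assumes "z \<in> polar_hull s1 s2 t1 t2" "0 < s1" "- pi < t1" "t1 \<le> t2" "t2 < 0"
  shows "Im z < 0"
proof -
  define e where "e = min (sin (- t1)) (sin (- t2))"
  have e: "0 < e" unfolding e_def using assms by (auto intro!: sin_gt_zero simp del: sin_minus)
  have "s1 * e \<le> Re (z * \<i>)"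
  proof (rule polar_hull_half_plane[OF assms(1)])
    fix r t assume rt: "s1 \<le> r" "r \<le> s2" "t1 \<le> t" "t \<le> t2"
    have "e \<le> sin (- t)"
    proof (cases "- t \<le> pi / 2")
      case True
      then have "sin (- t2) \<le> sin (- t)" using rt assms by (intro sin_monotone_2pi_le) auto
      then show ?thesis by (simp add: e_def)
    next
      case False
      then have "sin (pi - (- t1)) \<le> sin (pi - (- t))" using rt assms by (intro sin_monotone_2pi_le) auto
      then have "sin (- t1) \<le> sin (- t)" by (simp only: sin_pi_minus)
    then show ?thesis by (simp add: e_def)
    qed
    then have "s1 * e \<le> r * sin (- t)" using rt assms e by (intro mult_mono) auto
    then show "s1 * e \<le> Re (rcis r t * \<i>)" by simp
  qed
  moreover have "0 < s1 * e" using e assms by simp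
  ultimately show ?thesis by simp
qed

text \<open>For t1 \<le> pi/2 the line through 0 and \<open>cis t1\<close>, at distance sin t1 from
  1, separates 1 from the hull. For larger t1 the hull lies in the left half-plane, at distance at
  least 1 from 1.\<close>

lemma dist_one_polar_hull_upper:
  assumes z: "z \<in> polar_hull s1 s2 t1 t2" and "0 \<le> s1" "0 < t1" "t2 \<le> pi"
    and e: "e \<le> 1" "t1 \<le> pi / 2 \<Longrightarrow> e \<le> sin t1"
  shows "e \<le> norm (1 - z)"
proof (cases "t1 \<le> pi / 2")
  case True
  have "0 \<le> Re (z * (- \<i> * cis (- t1)))"
  proof (rule polar_hull_half_plane[OF z])
    fix r t assume rt: "s1 \<le> r" "r \<le> s2" "t1 \<le> t" "t \<le> t2"
    have "0 \<le> r * sin (t - t1)"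
      using rt assms by (intro mult_nonneg_nonneg sin_ge_zero) auto
    then show "0 \<le> Re (rcis r t * (- \<i> * cis (- t1)))"
      by (simp add: sin_diff algebra_simps)
  qed
  then have "sin t1 \<le> Im ((z - 1) * cis (- t1))" by (simp add: algebra_simps)
  also have "\<dots> \<le> norm (z - 1)" using abs_Im_le_cmod[of "(z - 1) * cis (- t1)"] by (simp add: norm_mult)
  finally show ?thesis using e(2)[OF True] by (simp add: norm_minus_commute)
next
  case False
  have "0 \<le> Re (z * (- 1))"
  proof (rule polar_hull_half_plane[OF z])
    fix r t assume rt: "s1 \<le> r" "r \<le> s2" "t1 \<le> t" "t \<le> t2"
    have "0 \<le> cos (pi - t)" using rt False assms by (intro cos_ge_zero) auto
    then show "0 \<le> Re (rcis r t * (- 1))" using rt assms by (auto simp: mult_nonneg_nonpos)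
  qed
  then show ?thesis using complex_Re_le_cmod[of "1 - z"] e(1) by simp
qed

lemma cnj_polar_hull:
  assumes "z \<in> polar_hull s1 s2 t1 t2"
  shows "cnj z \<in> polar_hull s1 s2 (- t2) (- t1)"
proof (rule polar_hull_induct[OF assms])
  have eq: "{z. cnj z \<in> polar_hull s1 s2 (- t2) (- t1)} = cnj -` polar_hull s1 s2 (- t2) (- t1)" by auto
  show "convex {z. cnj z \<in> polar_hull s1 s2 (- t2) (- t1)}"
    unfolding eq by (rule convex_linear_vimage[OF bounded_linear.linear[OF bounded_linear_cnj] convex_polar_hull])
  show "closed {z. cnj z \<in> polar_hull s1 s2 (- t2) (- t1)}"
    unfolding eq by (rule closed_vimage) (auto simp: polar_hull_def intro: continuous_intros)
next
  fix r t assume rt: "s1 \<le> r" "r \<le> s2" "t1 \<le> t" "t \<le> t2"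
  have "cnj (rcis r t) = rcis r (- t)" by (simp add: rcis_def cis_cnj)
  then have "cnj (rcis r t) \<in> polar_rect s1 s2 (- t2) (- t1)" using rt by (force simp: polar_rect_def)
  then show "cnj (rcis r t) \<in> polar_hull s1 s2 (- t2) (- t1)"
    using polar_rect_subset_polar_hull by blast
qed

lemma dist_one_polar_hull_lower:
  assumes z: "z \<in> polar_hull s1 s2 t1 t2" and "0 \<le> s1" "- pi \<le> t1" "t2 < 0"
    and e: "e \<le> 1" "- t2 \<le> pi / 2 \<Longrightarrow> e \<le> sin (- t2)"
  shows "e \<le> norm (1 - z)"
proof -
  have "e \<le> norm (1 - cnj z)"
    using assms by (intro dist_one_polar_hull_upper[OF cnj_polar_hull[OF z]]) auto
  also have "\<dots> = norm (1 - z)" using complex_mod_cnj[of "1 - z"] by simp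
  finally show ?thesis .
qed

section \<open>The Newton step in each half-plane\<close>

lemma abs_Re_Ln_le:
  assumes "d \<le> norm w" "0 < d" "norm w \<le> u" "- E \<le> ln d" "ln u \<le> E"
  shows "\<bar>Re (Ln w)\<bar> \<le> E"
proof -
  have "ln d \<le> ln (norm w)" "ln (norm w) \<le> ln u"
    using assms by (intro ln_mono; linarith)+
  moreover have "Re (Ln w) = ln (norm w)" using assms by (intro Re_Ln) auto
  ultimately show ?thesis using assms by linarith
qed

text \<open>Here 1 - z lies in the right half-plane with nonpositive imaginary part, so Im Ln(1 - z)
  is in [-pi/2, 0]. The numerator of \<open>phi'\<close> thus has imaginary part between 2 pi B and
  2 pi B + pi/2 \<le> 5/2 pi B. \<open>E\<close> bounds the logarithm of |1 - z|, which is between d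
  and 2.\<close>

lemma newton_step_upper:
  fixes B :: int
  assumes B: "1 \<le> B"
    and s: "s1 \<le> 1" "0.72 \<le> s1 * cos ((t2 - t1) / 2)" "0 \<le> s1"
    and t: "0 < t1" "t1 \<le> t2" "t2 \<le> pi"
    and d: "0 < d" "d \<le> 1" "t1 \<le> pi / 2 \<Longrightarrow> d \<le> sin t1"
    and E: "- E \<le> ln d" "ln 2 \<le> E"
    and z: "\<rho> \<in> chord_region s1 1 t1 t2" "c \<in> chord_region s1 1 t1 t2" "phi A B \<rho> = 0"
  shows "norm (\<rho> - (c - phi A B c / phi' A B c)) \<le>
    (1 / (0.72 * d) + (5 / 2 * pi * of_int B + E) / 0.72\<^sup>2) / (2 * (2 * pi * of_int B)) * norm (\<rho> - c) ^ 2"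
proof -
  let ?K = "polar_hull s1 1 t1 t2"
  let ?L = "\<lambda>z. - Ln (1 - z) + 2 * of_real pi * \<i> * of_int B"
  have sub: "chord_region s1 1 t1 t2 \<subseteq> ?K" using s t by (intro chord_region_subset_polar_hull)
  have le1: "norm z \<le> 1" if "z \<in> ?K" for z using norm_polar_hull_le[OF that s(3)] .
  have Im0: "0 \<le> Im z" if "z \<in> ?K" for z using Im_polar_hull_nonneg[OF that] s t by auto
  have m: "0.72 \<le> norm z" if "z \<in> ?K" for z
    using norm_polar_hull_ge[OF that s(3)] s t by linarith
  have d1: "d \<le> norm (1 - z)" if "z \<in> ?K" for z
    using dist_one_polar_hull_upper[OF that s(3) t(1,3) d(2,3)] .
  \<comment> \<open>The slit meets the closed unit disc only at 1, which the distance d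
    excludes.\<close>
  have slit: "1 - z \<notin> \<real>\<^sub>\<le>\<^sub>0" if "z \<in> ?K" for z
  proof
    assume *: "1 - z \<in> \<real>\<^sub>\<le>\<^sub>0"
    then have "z = 1"
      using le1[OF that] complex_Re_le_cmod[of z] by (auto simp: complex_nonpos_Reals_iff complex_eq_iff)
    then show False using d1[OF that] d(1) by simp
  qed
  have Ln: "- (pi / 2) \<le> Im (Ln (1 - z))" "Im (Ln (1 - z)) \<le> 0" if "z \<in> ?K" for z
  proof -
    have nz: "1 - z \<noteq> 0" using slit[OF that] by auto
    have "0 \<le> Re (1 - z)" using le1[OF that] complex_Re_le_cmod[of z] by simp
    then have *: "\<bar>Im (Ln (1 - z))\<bar> \<le> pi / 2" using Re_Ln_pos_le[OF nz] by simp
    then show "- (pi / 2) \<le> Im (Ln (1 - z))" by linarith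
    have "\<not> 0 < Im (1 - z)" using Im0[OF that] by simp
    then show "Im (Ln (1 - z)) \<le> 0" using Im_Ln_pos_lt[OF nz] * pi_gt_zero by linarith
  qed
  have Re: "\<bar>Re (Ln (1 - z))\<bar> \<le> E" if "z \<in> ?K" for z
    using d1[OF that] d(1) E norm_triangle_ineq4[of 1 z] le1[OF that]
    by (intro abs_Re_Ln_le[of d _ 2]) auto
  have ImL: "Im (?L z) = 2 * pi * of_int B - Im (Ln (1 - z))" "Re (?L z) = - Re (Ln (1 - z))" for z
    by auto
  have piB: "pi \<le> pi * of_int B" "0 < pi * of_int B" using B by auto
  have L: "norm (?L z) \<le> 5 / 2 * pi * of_int B + E" if "z \<in> ?K" for z
    using cmod_le[of "?L z"] Ln[OF that] Re[OF that] piB unfolding ImL by linarith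
  have cK: "c \<in> ?K" "\<rho> \<in> ?K" using z sub by auto
  have "2 * pi * of_int B \<le> norm (?L c) / 1"
    using abs_Im_le_cmod[of "?L c"] Ln[OF cK(1)] unfolding ImL div_by_1 by linarith
  also have "norm (?L c) / 1 \<le> norm (phi' A B c)"
    using le1[OF cK(1)] m[OF cK(1)] unfolding phi'_def norm_divide by (intro frac_le) auto
  finally have p: "2 * pi * of_int B \<le> norm (phi' A B c)" .
  show ?thesis
    by (rule newton_step_phi_bound[where K = ?K])
       (use cK Im0 m d1 slit L d(1) piB(2) p z(3) convex_polar_hull in auto)
qed

lemma newton_step_lower:
  fixes B :: int
  assumes B: "1 \<le> B"
    and s: "1 \<le> s2" "s2 \<le> 1.2" "0.72 \<le> cos ((t2 - t1) / 2)"
    and t: "- pi < t1" "t1 \<le> t2" "t2 < 0"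
    and d: "0 < d" "d \<le> 1" "- t2 \<le> pi / 2 \<Longrightarrow> d \<le> sin (- t2)"
    and E: "- E \<le> ln d" "ln 2.2 \<le> E"
    and z: "\<rho> \<in> chord_region 1 s2 t1 t2" "c \<in> chord_region 1 s2 t1 t2" "phi A B \<rho> = 0"
  shows "norm (\<rho> - (c - phi A B c / phi' A B c)) \<le>
    (1 / (0.72 * d) + (2 * pi * of_int B + E) / 0.72\<^sup>2) / (2 * (pi * (2 * of_int B - 1) / 1.2)) * norm (\<rho> - c) ^ 2"
proof -
  let ?K = "polar_hull 1 s2 t1 t2"
  let ?L = "\<lambda>z. - Ln (1 - z) + 2 * of_real pi * \<i> * of_int B"
  have sub: "chord_region 1 s2 t1 t2 \<subseteq> ?K" using s t by (intro chord_region_subset_polar_hull)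
  have le: "norm z \<le> 1.2" if "z \<in> ?K" for z using norm_polar_hull_le[OF that] s by auto
  have Im0: "Im z < 0" if "z \<in> ?K" for z using Im_polar_hull_neg[OF that] s t by auto
  have m: "0.72 \<le> norm z" if "z \<in> ?K" for z
    using norm_polar_hull_ge[OF that] s t by linarith
  have d1: "d \<le> norm (1 - z)" if "z \<in> ?K" for z
    using dist_one_polar_hull_lower[OF that _ _ t(3) d(2,3)] t by auto
  have slit: "1 - z \<notin> \<real>\<^sub>\<le>\<^sub>0" if "z \<in> ?K" for z
    using Im0[OF that] by (auto simp: complex_nonpos_Reals_iff)
  have Ln: "0 < Im (Ln (1 - z))" "Im (Ln (1 - z)) < pi" if "z \<in> ?K" for z
  proof -
    have nz: "1 - z \<noteq> 0" using slit[OF that] by auto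
    have "0 < Im (1 - z)" using Im0[OF that] by simp
    then show "0 < Im (Ln (1 - z))" "Im (Ln (1 - z)) < pi" using Im_Ln_pos_lt[OF nz] by auto
  qed
  have Re: "\<bar>Re (Ln (1 - z))\<bar> \<le> E" if "z \<in> ?K" for z
    using d1[OF that] d(1) E norm_triangle_ineq4[of 1 z] le[OF that]
    by (intro abs_Re_Ln_le[of d _ "2.2"]) auto
  have ImL: "Im (?L z) = 2 * pi * of_int B - Im (Ln (1 - z))" "Re (?L z) = - Re (Ln (1 - z))" for z
    by auto
  have piB: "pi \<le> pi * of_int B" using B by auto
  have pB: "0 < pi * (2 * of_int B - 1)" using B by (intro mult_pos_pos) auto
  have eq: "pi * (2 * of_int B - 1) = 2 * pi * of_int B - pi" by (simp add: algebra_simps)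
  have L: "norm (?L z) \<le> 2 * pi * of_int B + E" if "z \<in> ?K" for z
    using cmod_le[of "?L z"] Ln[OF that] Re[OF that] piB pi_gt_zero unfolding ImL by linarith
  have cK: "c \<in> ?K" "\<rho> \<in> ?K" using z sub by auto
  have "pi * (2 * of_int B - 1) \<le> norm (?L c)"
    using abs_Im_le_cmod[of "?L c"] Ln[OF cK(1)] unfolding ImL eq by linarith
  then have "pi * (2 * of_int B - 1) / 1.2 \<le> norm (?L c) / norm c"
    using le[OF cK(1)] m[OF cK(1)] pB by (intro frac_le) auto
  then have p: "pi * (2 * of_int B - 1) / 1.2 \<le> norm (phi' A B c)"
    unfolding phi'_def norm_divide .
  show ?thesis
    by (rule newton_step_phi_bound[where K = ?K])
       (use cK Im0 m d1 slit L d(1) pB p z(3) convex_polar_hull in auto)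
qed

section \<open>Numerical constants\<close>

text \<open>For A \<noteq> 0 the least value of |2 A| - 1/8 is 15/8. The cubic bound gives sin x
  \<ge> 0.58 x up to pi/2, and 0.58 * 15/8 * pi exceeds 2.\<close>

lemma sin_bound_nonzero:
  assumes "15 / 8 * pi / b \<le> x" "x \<le> pi / 2" "(2::real) \<le> b"
  shows "2 / b \<le> sin x"
proof -
  have x0: "0 \<le> x" using assms(1,3) by (intro order_trans[OF _ assms(1)]) auto
  have "x \<le> 1.58" using assms(2) pi_approx by simp
  then have "x\<^sup>2 \<le> 1.58\<^sup>2" using x0 by (intro power_mono)
  then have "0.58 \<le> 1 - x\<^sup>2 / 6" by (simp add: power2_eq_square)
  then have "15 / 8 * pi / b * 0.58 \<le> x * (1 - x\<^sup>2 / 6)" using assms x0 by (intro mult_mono) auto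
  moreover have "2 / b \<le> 15 / 8 * pi / b * 0.58"
    using pi_approx assms(3) by (simp add: divide_simps)
  ultimately show ?thesis using sin_ge_cubic[OF x0] by linarith
qed

lemma sin_bound_zero:
  assumes "(1::real) \<le> b"
  shows "1 / (8 * b) \<le> sin (pi / (24 * b))"
proof -
  let ?x = "pi / (24 * b)"
  have x: "0 \<le> ?x" "?x \<le> 1 / 7" using pi_approx assms by (simp_all add: divide_simps)
  then have "?x\<^sup>2 \<le> (1 / 7)\<^sup>2" by (intro power_mono)
  then have "0.99 \<le> 1 - ?x\<^sup>2 / 6" by (simp add: power2_eq_square)
  then have "?x * 0.99 \<le> ?x * (1 - ?x\<^sup>2 / 6)" using x by (intro mult_left_mono)
  moreover have "1 / (8 * b) \<le> ?x * 0.99"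
    using pi_approx assms by (simp add: divide_simps)
  ultimately show ?thesis using sin_ge_cubic[OF x(1)] by linarith
qed

lemma cos_small_ge:
  assumes "0 \<le> h" "h \<le> pi / 16"
  shows "0.98 \<le> cos (h::real)"
proof -
  have "h \<le> 0.2" using assms pi_approx by simp
  then have "h\<^sup>2 \<le> 0.2\<^sup>2" using assms by (intro power_mono)
  then show ?thesis using cos_ge_one_minus_half_square[of h] by (simp add: power2_eq_square)
qed

text \<open>The first bound is 1 - pi/12 rounded down. Multiplied by the 0.98 of
  \<open>cos_small_ge\<close> it exceeds 0.72, the lower bound for |z| on the hull.\<close>

lemma exp_kappa_ge:
  assumes "(1::real) \<le> b"
  shows "0.738 \<le> exp (- kappa / (2 * pi * b))" "exp (- kappa / (2 * pi * b)) \<le> 1"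
proof -
  have "kappa / (2 * pi * b) \<le> (pi\<^sup>2 / 6) / (2 * pi * 1)"
    using kappa_le kappa_nonneg assms by (intro frac_le mult_left_mono) auto
  also have "\<dots> = pi / 12" by (simp add: power2_eq_square)
  also have "\<dots> \<le> 0.262" using pi_approx by simp
  finally show "0.738 \<le> exp (- kappa / (2 * pi * b))"
    using exp_ge_add_one_self[of "- kappa / (2 * pi * b)"] by simp
  show "exp (- kappa / (2 * pi * b)) \<le> 1" using kappa_nonneg assms by simp
qed

text \<open>A < 0 forces B \<ge> 3, which makes the exponent at most pi/30.\<close>

lemma exp_kappa_le:
  assumes "(3::real) \<le> b"
  shows "exp (kappa / (pi * (2 * b - 1))) \<le> 1.2" "1 \<le> exp (kappa / (pi * (2 * b - 1)))"
proof -
  let ?y = "kappa / (pi * (2 * b - 1))"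
  have y0: "0 \<le> ?y" using kappa_nonneg assms by simp
  have "?y \<le> (pi\<^sup>2 / 6) / (pi * 5)"
    using kappa_le kappa_nonneg assms by (intro frac_le mult_left_mono) auto
  also have "\<dots> = pi / 30" by (simp add: power2_eq_square)
  finally have "?y \<le> 11 / 100" using pi_approx by simp
  moreover have "?y\<^sup>2 \<le> 121 / 10000" using power_mono[OF calculation y0, of 2] by (simp add: power2_eq_square)
  ultimately have "exp ?y \<le> 6 / 5" using exp_bound[OF y0] by linarith
  then show "exp ?y \<le> 1.2" by simp
  show "1 \<le> exp ?y" using y0 by simp
qed

section \<open>The three cases for the sign of A\<close>

theorem theorem6p3:
  fixes A B :: int and \<rho> c c' :: complex
  assumes "- of_int B / 2 < (of_int A :: real)"
    and "(of_int A :: real) \<le> of_int B / 2"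
    and "\<rho> \<in> region' A B"
    and "c \<in> region' A B"
    and "\<rho> \<noteq> c"
    and "phi A B \<rho> = 0"
    and "c' = c - phi A B c / phi' A B c"
  shows "norm (\<rho> - c') < of_int B * norm (\<rho> - c) ^ 2 * (if A \<noteq> 0 then 0.76 else 2.51)"
proof -
  define b where "b = real_of_int B"
  define a where "a = real_of_int A"
  have AB: "- B < 2 * A" "2 * A \<le> B" using assms(1,2) by linarith+
  then have B1: "1 \<le> B" by linarith
  then have b1: "1 \<le> b" by (simp add: b_def)
  have sq: "0 < norm (\<rho> - c) ^ 2" using assms(5) by simp
  note pi = pi_approx
  have conclude: ?thesis
    if "norm (\<rho> - (c - phi A B c / phi' A B c)) \<le> C * norm (\<rho> - c) ^ 2"
      "C < b * (if A \<noteq> 0 then 0.76 else 2.51)" for C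
    using that(1) mult_strict_right_mono[OF that(2) sq] by (simp add: assms(7) b_def mult_ac)
  \<comment> \<open>X will be linear in b, as is the divisor, so the target b * k leaves a spare
    factor b. It is estimated by the least b of the case.\<close>
  have quot: "X / (2 * (2 * pi * b)) < b * k" if "X < b * (b * (k * (4 * pi)))" for X k
    using that b1 by (simp add: pos_divide_less_eq mult_ac)
  consider "A = 0" | "A > 0" | "A < 0" by linarith
  then show ?thesis
  proof cases
    case 1
    have p: "r1 A B = exp (- kappa / (2 * pi * b))" "r2 A B = 1" "theta1 A B = pi / (24 * b)"
      "theta2 A B = pi / (8 * b)"
      using 1 B1 by (simp_all add: r1_def r2_def theta1_def theta2_def b_def)
    have h: "(pi / (8 * b) - pi / (24 * b)) / 2 = pi / (24 * b)" by (simp add: field_simps)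
    have hc: "0.98 \<le> cos (pi / (24 * b))"
      using b1 by (intro cos_small_ge) (auto simp: divide_simps)
    have "0.738 * 0.98 \<le> exp (- kappa / (2 * pi * b)) * cos (pi / (24 * b))"
      using hc exp_kappa_ge(1)[OF b1] by (intro mult_mono) auto
    then have s: "0.72 \<le> exp (- kappa / (2 * pi * b)) * cos ((pi / (8 * b) - pi / (24 * b)) / 2)"
      unfolding h by simp
    have lnb: "ln b \<le> b - 1" using b1 ln_le_minus_one[of b] by simp
    have "ln (8 * b) = 3 * ln 2 + ln b"
      using b1 ln_realpow[of 2 3] by (simp add: ln_mult)
    \<comment> \<open>25/12 is 3 * 25/36, from ln 2 \<le> 25/36; since it exceeds 1, 25/12 + (b - 1)
      is at most 25/12 * b.\<close>
    then have E: "- (25 / 12 * b) \<le> ln (1 / (8 * b))"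
      using lnb ln2_le_25_over_36 b1 by (simp add: ln_div)
    have E2: "ln 2 \<le> 25 / 12 * b" using ln2_le_25_over_36 b1 by linarith
    show ?thesis
    proof (rule conclude)
      show "norm (\<rho> - (c - phi A B c / phi' A B c)) \<le>
        (1 / (0.72 * (1 / (8 * b))) + (5 / 2 * pi * of_int B + 25 / 12 * b) / 0.72\<^sup>2) / (2 * (2 * pi * of_int B))
          * norm (\<rho> - c) ^ 2"
        using assms(3,4,6) b1 B1 s E E2 exp_kappa_ge(2)[OF b1] sin_bound_zero[OF b1]
        by (intro newton_step_upper[where ?s1.0 = "exp (- kappa / (2 * pi * b))" and ?t1.0 = "pi / (24 * b)" and ?t2.0 = "pi / (8 * b)"])
           (auto simp: region'_def p divide_simps)
      have "1 / (0.72 * (1 / (8 * b))) + (5 / 2 * pi * b + 25 / 12 * b) / 0.72\<^sup>2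
        = b * (8 / 0.72 + (5 / 2 * pi + 25 / 12) / 0.72\<^sup>2)" using b1 by (simp add: field_simps)
      also have "\<dots> < b * (2.51 * (4 * pi))"
        using b1 pi by (intro mult_strict_left_mono) (auto simp: power2_eq_square field_simps)
      also have "\<dots> \<le> b * (b * (2.51 * (4 * pi)))" using b1 by simp
      finally have "(1 / (0.72 * (1 / (8 * b))) + (5 / 2 * pi * b + 25 / 12 * b) / 0.72\<^sup>2) / (2 * (2 * pi * b)) < b * 2.51"
        by (rule quot)
      then show "(1 / (0.72 * (1 / (8 * b))) + (5 / 2 * pi * of_int B + 25 / 12 * b) / 0.72\<^sup>2) / (2 * (2 * pi * of_int B))
          < b * (if A \<noteq> 0 then 0.76 else 2.51)"
        using 1 by (simp only: b_def[symmetric] simp_thms if_False)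
    qed
  next
    case 2
    then have b2: "2 \<le> b" using AB by (simp add: b_def)
    \<comment> \<open>By integrality 2 A < B leaves room for the 1/8 in \<open>theta2\<close>, which
      keeps the sector below pi.\<close>
    have "2 * A = B \<or> 2 * A + 1 \<le> B" using AB by linarith
    then have a1: "1 \<le> a" "2 * a \<le> b" "2 * a = b \<or> 2 * a + 1 \<le> b"
      using 2 AB unfolding a_def b_def by linarith+
    define t where "t = (if 2 * A \<noteq> B then pi * (2 * a + 1 / 8) / b else pi)"
    define t' where "t' = pi * (2 * a - 1 / 8) / b"
    have p: "r1 A B = exp (- kappa / (2 * pi * b))" "r2 A B = 1" "theta1 A B = t'" "theta2 A B = t"
      using 2 by (simp_all add: r1_def r2_def theta1_def theta2_def t_def t'_def a_def b_def)
    have AB_iff: "2 * A = B \<longleftrightarrow> 2 * a = b" unfolding a_def b_def by linarith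
    have t': "15 / 8 * pi / b \<le> t'" unfolding t'_def using a1 b2 by (simp add: field_simps)
    have t'0: "0 < t'" using t' b2 by (intro less_le_trans[OF _ t']) auto
    have t'h: "t' \<le> t \<and> t - t' \<le> pi / 4 / b \<and> t \<le> pi"
    proof (cases "2 * A = B")
      case True
      then have "t' = pi - pi / 8 / b" "t = pi"
        unfolding t'_def t_def using AB_iff b2 by (auto simp: field_simps)
      moreover have "pi / 4 / b = 2 * (pi / 8 / b)" "0 \<le> pi / 8 / b" using b2 by simp_all
      ultimately show ?thesis by linarith
    next
      case False
      then have "t = t' + pi / 4 / b" unfolding t_def t'_def using b2 by (simp add: field_simps)
      moreover have "pi * (2 * a + 1 / 8) \<le> pi * b" using False AB_iff a1 by (intro mult_left_mono) auto
      then have "t \<le> pi" unfolding t_def using b2 False by (simp add: pos_divide_le_eq)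
      ultimately show ?thesis using b2 by simp
    qed
    have "pi / 4 / b \<le> pi / 8" using b2 by (simp add: field_simps)
    then have hc: "0.98 \<le> cos ((t - t') / 2)" using t'h by (intro cos_small_ge) auto
    have "0.738 * 0.98 \<le> exp (- kappa / (2 * pi * b)) * cos ((t - t') / 2)"
      using hc exp_kappa_ge(1)[OF b1] by (intro mult_mono) auto
    then have s: "0.72 \<le> exp (- kappa / (2 * pi * b)) * cos ((t - t') / 2)" by simp
    have lnb: "ln b \<le> b" using b1 ln_le_minus_one[of b] by simp
    moreover have "ln (2 / b) = ln 2 - ln b" "0 \<le> ln (2::real)" using b2 by (simp_all add: ln_div)
    ultimately have E: "- b \<le> ln (2 / b)" by linarith
    have E2: "ln 2 \<le> b" using ln2_le_25_over_36 b1 by linarith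
    show ?thesis
    proof (rule conclude)
      show "norm (\<rho> - (c - phi A B c / phi' A B c)) \<le>
        (1 / (0.72 * (2 / b)) + (5 / 2 * pi * of_int B + b) / 0.72\<^sup>2) / (2 * (2 * pi * of_int B))
          * norm (\<rho> - c) ^ 2"
        using assms(3,4,6) b2 B1 s E E2 exp_kappa_ge(2)[OF b1] sin_bound_nonzero[OF t' _ b2] t'h t'0
        by (intro newton_step_upper[where ?s1.0 = "exp (- kappa / (2 * pi * b))" and ?t1.0 = t' and ?t2.0 = t])
           (auto simp: region'_def p)
      have "1 / (0.72 * (2 / b)) + (5 / 2 * pi * b + b) / 0.72\<^sup>2
        = b * (1 / 1.44 + (5 / 2 * pi + 1) / 0.72\<^sup>2)" using b1 by (simp add: field_simps)
      also have "\<dots> < b * (2 * (0.76 * (4 * pi)))"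
        using b1 pi by (intro mult_strict_left_mono) (auto simp: power2_eq_square field_simps)
      also have "\<dots> \<le> b * (b * (0.76 * (4 * pi)))" using b2 by (intro mult_left_mono mult_right_mono) auto
      finally have "(1 / (0.72 * (2 / b)) + (5 / 2 * pi * b + b) / 0.72\<^sup>2) / (2 * (2 * pi * b)) < b * 0.76"
        by (rule quot)
      then show "(1 / (0.72 * (2 / b)) + (5 / 2 * pi * of_int B + b) / 0.72\<^sup>2) / (2 * (2 * pi * of_int B))
          < b * (if A \<noteq> 0 then 0.76 else 2.51)"
        using 2 by (simp only: b_def[symmetric] less_imp_neq[symmetric] simp_thms if_True)
    qed
  next
    case 3
    then have b3: "3 \<le> b" using AB by (simp add: b_def)
    \<comment> \<open>Integrality again: 2 A \<ge> 1 - B gives 2 A - 1/8 > - B, so the sector stays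
      strictly above the angle -pi.\<close>
    have a1: "a \<le> - 1" "1 - b \<le> 2 * a" using 3 AB unfolding a_def b_def by linarith+
    define t where "t = pi * (2 * a + 1 / 8) / b"
    define t' where "t' = pi * (2 * a - 1 / 8) / b"
    have p: "r1 A B = 1" "r2 A B = exp (kappa / (pi * (2 * b - 1)))" "theta1 A B = t'" "theta2 A B = t"
      using 3 AB by (simp_all add: r1_def r2_def theta1_def theta2_def t_def t'_def a_def b_def)
    have "pi * (15 / 8) \<le> pi * (- (2 * a + 1 / 8))" using a1 by (intro mult_left_mono) auto
    then have "pi * (15 / 8) / b \<le> pi * (- (2 * a + 1 / 8)) / b" using b3 by (intro divide_right_mono) auto
    then have t: "15 / 8 * pi / b \<le> - t"
      by (simp only: t_def mult_minus_right minus_divide_left mult.commute[of pi "15 / 8"])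
    have t0: "t < 0" using less_le_trans[OF _ t, of 0] b3 by simp
    have "pi * - b < pi * (2 * a - 1 / 8)" using a1 by (intro mult_strict_left_mono) auto
    then have t'0: "- pi < t'" unfolding t'_def using b3 by (simp add: pos_less_divide_eq)
    have tt: "t = t' + pi / 4 / b" unfolding t_def t'_def using b3 by (simp add: field_simps)
    have q: "0 \<le> pi / 4 / b" "pi / 4 / b \<le> pi / 8" using b3 by (simp_all add: field_simps)
    then have t'h: "t' \<le> t" unfolding tt by linarith
    have hc: "0.98 \<le> cos ((t - t') / 2)"
    proof (rule cos_small_ge)
      show "0 \<le> (t - t') / 2" using t'h by simp
      have "t - t' \<le> pi / 8" unfolding tt using q(2) by simp
      then show "(t - t') / 2 \<le> pi / 16" by simp
    qed
    have lnb: "ln b \<le> b" using b1 ln_le_minus_one[of b] by simp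
    moreover have "ln (2 / b) = ln 2 - ln b" "0 \<le> ln (2::real)" using b3 by (simp_all add: ln_div)
    ultimately have E: "- b \<le> ln (2 / b)" by linarith
    have E2: "ln 2.2 \<le> b" using ln_le_minus_one[of "2.2"] b3 by simp
    show ?thesis
    proof (rule conclude)
      show "norm (\<rho> - (c - phi A B c / phi' A B c)) \<le>
        (1 / (0.72 * (2 / b)) + (2 * pi * of_int B + b) / 0.72\<^sup>2) / (2 * (pi * (2 * of_int B - 1) / 1.2))
          * norm (\<rho> - c) ^ 2"
        using assms(3,4,6) b3 B1 hc E E2 exp_kappa_le[OF b3] sin_bound_nonzero[OF t] t'h t'0 t0
        by (intro newton_step_lower[where ?s2.0 = "exp (kappa / (pi * (2 * b - 1)))" and ?t1.0 = t' and ?t2.0 = t])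
           (auto simp: region'_def p)
      have "1 / (0.72 * (2 / b)) + (2 * pi * b + b) / 0.72\<^sup>2
        = b * (1 / 1.44 + (2 * pi + 1) / 0.72\<^sup>2)" using b1 by (simp add: field_simps)
      \<comment> \<open>The factor 5 is the least value of 2 b - 1, as b \<ge> 3.\<close>
      also have "\<dots> < b * (0.76 * (2 * (pi * 5 / 1.2)))"
        using b1 pi by (intro mult_strict_left_mono) (auto simp: power2_eq_square field_simps)
      also have "\<dots> \<le> b * (0.76 * (2 * (pi * (2 * b - 1) / 1.2)))"
        using b3 by (intro mult_left_mono divide_right_mono) auto
      finally show "(1 / (0.72 * (2 / b)) + (2 * pi * of_int B + b) / 0.72\<^sup>2) / (2 * (pi * (2 * of_int B - 1) / 1.2))
          < b * (if A \<noteq> 0 then 0.76 else 2.51)"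
        unfolding b_def[symmetric] using b3 3 by (subst pos_divide_less_eq) (auto simp: mult_ac)
    qed
  qed
qed

end
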